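(* Let $S$ be a topological semigroup and let $(X,d)$ be a metric space equipped with a non-expansive action of $S$. Then the following are equivalent: (1) The space $X$ can be extended by adding a fixed point of $S$, i.e. there exist a metric space $(Y,d_Y)$ equipped with a non-expansive action of $S$ that has a fixed point (a point $z\in Y$ with $s\cdot z=z$ for all $s\in S$), and an isometric and equivariant embedding of $X$ into $Y$. (2) For every $x\in X$, the orbit $S\cdot x=\{s\cdot x\mid s\in S\}$ is a bounded subset of $X$.
   Context: An action of a semigroup $S$ on a set $X$ is a map $\pi:S\times X\to X$, written $\pi(s,x)=s\cdot x$, with $(st)\cdot x=s\cdot(t\cdot x)$ for all $s,t\in S$, $x\in X$. A non-expansive action of a topological semigroup $S$ on a metric space $(X,d)$ is an action such that $d(s\cdot x,s\cdot y)\le d(x,y)$ for all $s\in S$ and $x,y\in X$, and such that, in addition, the map $S\times X\to X$ is (jointly) continuous; continuity is always included in the term "non-expansive action". A map $f:X\to Y$ between spaces with $S$-actions is equivariant if $f(s\cdot x)=s\cdot f(x)$ for all $s\in S$, $x\in X$. The semigroup $S$ need not have a unit, so $x$ need not belong to $S\cdot x$. *)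

theory Defs
  imports "HOL-Analysis.Analysis"
begin

text \<open>The acting semigroup is a type of class \<^class>\<open>topological_semigroup_mult\<close>, which requires
  neither a unit nor a separation axiom. Metric spaces are values of type \<open>'a metric\<close>, so that one
  can quantify over them and the carrier may be empty. Actions are constrained only on
  the carrier.\<close>

definition semigroup_action_on :: "'a set \<Rightarrow> ('s::semigroup_mult \<Rightarrow> 'a \<Rightarrow> 'a) \<Rightarrow> bool" where
  "semigroup_action_on A act \<longleftrightarrow>
     (\<forall>s. \<forall>x\<in>A. act s x \<in> A) \<and>
     (\<forall>s t. \<forall>x\<in>A. act (s * t) x = act s (act t x))"

definition nonexpansive_action ::
  "'a metric \<Rightarrow> ('s::topological_semigroup_mult \<Rightarrow> 'a \<Rightarrow> 'a) \<Rightarrow> bool" where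
  "nonexpansive_action X act \<longleftrightarrow>
     semigroup_action_on (mspace X) act \<and>
     (\<forall>s. \<forall>x\<in>mspace X. \<forall>y\<in>mspace X. mdist X (act s x) (act s y) \<le> mdist X x y) \<and>
     continuous_map (prod_topology euclidean (mtopology_of X)) (mtopology_of X) (\<lambda>(s, x). act s x)"

definition isometric_embedding :: "'a metric \<Rightarrow> 'b metric \<Rightarrow> ('a \<Rightarrow> 'b) \<Rightarrow> bool" where
  "isometric_embedding X Y e \<longleftrightarrow>
     e \<in> mspace X \<rightarrow> mspace Y \<and>
     (\<forall>x\<in>mspace X. \<forall>y\<in>mspace X. mdist Y (e x) (e y) = mdist X x y)"

definition equivariant_on ::
  "'a set \<Rightarrow> ('s \<Rightarrow> 'a \<Rightarrow> 'a) \<Rightarrow> ('s \<Rightarrow> 'b \<Rightarrow> 'b) \<Rightarrow> ('a \<Rightarrow> 'b) \<Rightarrow> bool" where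
  "equivariant_on A actA actB f \<longleftrightarrow> (\<forall>s. \<forall>x\<in>A. f (actA s x) = actB s (f x))"

definition fixed_point_extension ::
  "'a metric \<Rightarrow> ('s::topological_semigroup_mult \<Rightarrow> 'a \<Rightarrow> 'a) \<Rightarrow>
   'b metric \<Rightarrow> ('s \<Rightarrow> 'b \<Rightarrow> 'b) \<Rightarrow> bool" where
  "fixed_point_extension X actX Y actY \<longleftrightarrow>
     nonexpansive_action Y actY \<and>
     (\<exists>z\<in>mspace Y. \<forall>s. actY s z = z) \<and>
     (\<exists>e. isometric_embedding X Y e \<and> equivariant_on (mspace X) actX actY e)"

definition orbit_of :: "('s \<Rightarrow> 'a \<Rightarrow> 'a) \<Rightarrow> 'a \<Rightarrow> 'a set" where
  "orbit_of act x = {act s x | s. True}"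

definition bounded_orbits :: "'a metric \<Rightarrow> ('s \<Rightarrow> 'a \<Rightarrow> 'a) \<Rightarrow> bool" where
  "bounded_orbits X act \<longleftrightarrow>
     (\<forall>x\<in>mspace X. Metric_space.mbounded (mspace X) (mdist X) (orbit_of act x))"

text \<open>HOL cannot quantify over types inside a formula, so ``there is a metric space \<open>Y\<close>'' has to be
  read at a fixed type. An equivalence at \<open>'a option\<close>, which has room for the carrier of \<open>X\<close> and
  one further point, together with an implication at a free type variable \<open>'b\<close> expresses
  the equivalence for \<open>Y\<close> ranging over all types.\<close>

end

theory Submission
  imports Defs
begin

text \<open>
  A fixed point \<open>z\<close> confines every orbit to a ball around itself, since
  \<open>d (s \<cdot> x) z = d (s \<cdot> x) (s \<cdot> z) \<le> d x z\<close>; this ball may be read off in \<open>X\<close> by the triangle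
  inequality (\<open>fixed_point_extension_imp_bounded_orbits\<close>).

  Conversely, an extension of \<open>X\<close> by one fixed point is determined by the function
  \<open>\<phi> x = d x z\<close>. The triangle inequality asks that \<open>\<bar>\<phi> x - \<phi> y\<bar> \<le> d x y \<le> \<phi> x + \<phi> y\<close>, the
  separation of \<open>z\<close> from \<open>X\<close> that \<open>\<phi> > 0\<close>, and non-expansiveness that \<open>\<phi> (s \<cdot> x) \<le> \<phi> x\<close>.
  The distance to a point \<open>x\<^sub>0\<close> of \<open>X\<close> satisfies all but the last condition, up to positivity.
  If orbits are bounded, it can be replaced by its supremum over \<open>{x} \<union> S \<cdot> x\<close>. Moving
  from \<open>x\<close> to \<open>s \<cdot> x\<close> only shrinks this set, so the supremum decreases along orbits, and it is
  \<open>1\<close>-Lipschitz because \<open>S\<close> acts by \<open>1\<close>-Lipschitz maps. Adding \<open>1\<close> makes it positive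
  (\<open>exists_decreasing_distance_function\<close>).

  Joint continuity of the extended action costs nothing more: for maps that do not increase
  distances it amounts to continuity of each orbit map \<open>s \<mapsto> s \<cdot> y\<close>
  (\<open>nonexpansive_action_iff_continuous_orbit_maps\<close>), and the orbit map of the new point is constant.
\<close>

section \<open>Continuity of non-expansive actions\<close>

text \<open>Continuity in the two variables separately gives joint continuity here because
  \<open>d (t \<cdot> y) (s \<cdot> x) \<le> d y x + d (t \<cdot> x) (s \<cdot> x)\<close>: the first summand is controlled uniformly in \<open>t\<close>,
  the second by the orbit map of \<open>x\<close>.\<close>

lemma nonexpansive_action_iff_continuous_orbit_maps:
  fixes X :: "'a metric"
    and act :: "'s::topological_semigroup_mult \<Rightarrow> 'a \<Rightarrow> 'a"
  shows "nonexpansive_action X act \<longleftrightarrow>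
     semigroup_action_on (mspace X) act \<and>
     (\<forall>s. \<forall>x\<in>mspace X. \<forall>y\<in>mspace X. mdist X (act s x) (act s y) \<le> mdist X x y) \<and>
     (\<forall>x\<in>mspace X. continuous_map euclidean (mtopology_of X) (\<lambda>s. act s x))"
    (is "_ \<longleftrightarrow> ?action \<and> ?nonexp \<and> ?orbits")
proof -
  interpret X: Metric_space "mspace X" "mdist X"
    by simp
  have "continuous_map (prod_topology euclidean (mtopology_of X)) (mtopology_of X) (\<lambda>(s, x). act s x)
      \<longleftrightarrow> ?orbits" (is "?joint \<longleftrightarrow> _") if ?action ?nonexp
  proof
    assume joint: ?joint
    show ?orbits
    proof
      fix x assume "x \<in> mspace X"
      then have "continuous_map euclidean (prod_topology euclidean (mtopology_of X)) (\<lambda>s::'s. (s, x))"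
        by (simp add: continuous_map_pairwise o_def)
      from continuous_map_compose[OF this joint]
      show "continuous_map euclidean (mtopology_of X) (\<lambda>s. act s x)"
        by (simp add: o_def)
    qed
  next
    assume orbits: ?orbits
    have in_X: "act s x \<in> mspace X" if "x \<in> mspace X" for s x
      using \<open>?action\<close> that by (simp add: semigroup_action_on_def)
    have "\<exists>U. openin (prod_topology euclidean (mtopology_of X)) U \<and> (s, x) \<in> U \<and>
            (\<forall>p\<in>U. (case p of (t, y) \<Rightarrow> act t y) \<in> X.mball (act s x) \<epsilon>)"
      if x: "x \<in> mspace X" and "\<epsilon> > 0" for s :: 's and x and \<epsilon> :: real
    proof -
      have "continuous_map euclidean X.mtopology (\<lambda>s. act s x)"
        using orbits x by (simp add: mtopology_of_def)
      then obtain V where V: "open V" "s \<in> V" "\<And>t. t \<in> V \<Longrightarrow> mdist X (act s x) (act t x) < \<epsilon>/2"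
        unfolding X.continuous_map_to_metric using \<open>\<epsilon> > 0\<close>
        by (metis UNIV_I X.in_mball half_gt_zero open_openin topspace_euclidean)
      have "act t y \<in> X.mball (act s x) \<epsilon>" if "t \<in> V" "y \<in> X.mball x (\<epsilon>/2)" for t y
      proof -
        have y: "y \<in> mspace X" "mdist X x y < \<epsilon>/2"
          using that by auto
        have "mdist X (act s x) (act t y) \<le> mdist X (act s x) (act t x) + mdist X (act t x) (act t y)"
          using x y in_X by (intro X.triangle) auto
        also have "\<dots> < \<epsilon>"
          using V(3)[OF \<open>t \<in> V\<close>] \<open>?nonexp\<close> x y by (smt (verit) field_sum_of_halves)
        finally show ?thesis
          using x y in_X by simp
      qed
      moreover have "openin (prod_topology euclidean (mtopology_of X)) (V \<times> X.mball x (\<epsilon>/2))"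
        using V(1) by (simp add: openin_prod_Times_iff mtopology_of_def)
      ultimately show ?thesis
        using V(2) x \<open>\<epsilon> > 0\<close> by (intro exI[of _ "V \<times> X.mball x (\<epsilon>/2)"]) auto
    qed
    then have "continuous_map (prod_topology euclidean (mtopology_of X)) X.mtopology
        (\<lambda>(s, x). act s x)"
      unfolding X.continuous_map_to_metric by auto
    then show ?joint
      by (simp add: mtopology_of_def)
  qed
  then show ?thesis
    unfolding nonexpansive_action_def by blast
qed

lemma isometric_embedding_imp_continuous_map:
  assumes "isometric_embedding X Y e"
  shows "continuous_map (mtopology_of X) (mtopology_of Y) e"
  using assms
  by (intro Lipschitz_continuous_imp_continuous_map)
    (auto simp: isometric_embedding_def Lipschitz_continuous_map_def intro!: exI[of _ 1])

section \<open>Fixed points bound orbits\<close>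

lemma fixed_point_extension_imp_bounded_orbits:
  fixes X :: "'a metric"
    and act :: "'s::topological_semigroup_mult \<Rightarrow> 'a \<Rightarrow> 'a"
  assumes "semigroup_action_on (mspace X) act"
    and "fixed_point_extension X act Y actY"
  shows "bounded_orbits X act"
proof -
  interpret X: Metric_space "mspace X" "mdist X"
    by simp
  obtain z e where z: "z \<in> mspace Y" "\<And>s. actY s z = z"
    and emb: "isometric_embedding X Y e" and equiv: "equivariant_on (mspace X) act actY e"
    using assms(2) by (auto simp: fixed_point_extension_def)
  have e: "\<And>x. x \<in> mspace X \<Longrightarrow> e x \<in> mspace Y"
      "\<And>x y. x \<in> mspace X \<Longrightarrow> y \<in> mspace X \<Longrightarrow> mdist Y (e x) (e y) = mdist X x y"
      "\<And>s x. x \<in> mspace X \<Longrightarrow> e (act s x) = actY s (e x)"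
    using emb equiv by (auto simp: isometric_embedding_def equivariant_on_def)
  have nonexp: "mdist Y (actY s x) (actY s y) \<le> mdist Y x y"
    if "x \<in> mspace Y" "y \<in> mspace Y" for s x y
    using assms(2) that by (simp add: fixed_point_extension_def nonexpansive_action_def)
  have in_X: "act s x \<in> mspace X" if "x \<in> mspace X" for s x
    using assms(1) that by (simp add: semigroup_action_on_def)
  have "X.mbounded (orbit_of act x)" if x: "x \<in> mspace X" for x
  proof -
    have "mdist X (act s x) (act t x) \<le> 2 * mdist Y (e x) z" for s t
    proof -
      have near_z: "mdist Y (e (act s x)) z \<le> mdist Y (e x) z" for s
        using nonexp[of "e x" z s] z e x by simp
      have "mdist X (act s x) (act t x) = mdist Y (e (act s x)) (e (act t x))"
        using e(2) in_X x by simp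
      also have "\<dots> \<le> mdist Y (e (act s x)) z + mdist Y z (e (act t x))"
        using e(1) in_X x z by (intro mdist_triangle) auto
      also have "\<dots> \<le> 2 * mdist Y (e x) z"
        using near_z[of s] near_z[of t] by (simp add: mdist_commute)
      finally show ?thesis .
    qed
    then show ?thesis
      using in_X x by (auto simp: X.mbounded_alt orbit_of_def)
  qed
  then show ?thesis
    by (simp add: bounded_orbits_def)
qed

section \<open>The distance to the added point\<close>

text \<open>The function produced here is the distance to the point to be added. In the construction,
  \<open>H x\<close> collects the distances from \<open>x\<^sub>0\<close> to \<open>{x} \<union> S \<cdot> x\<close>; the point \<open>x\<close> has to be adjoined
  because it may lie outside its orbit, and the bound \<open>d x y \<le> \<phi> x + \<phi> y\<close> needs \<open>\<phi> x \<ge> d x\<^sub>0 x\<close>.\<close>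

lemma exists_decreasing_distance_function:
  fixes X :: "'a metric"
    and act :: "'s::semigroup_mult \<Rightarrow> 'a \<Rightarrow> 'a"
  assumes action: "semigroup_action_on (mspace X) act"
    and nonexp: "\<And>s x y. x \<in> mspace X \<Longrightarrow> y \<in> mspace X \<Longrightarrow>
      mdist X (act s x) (act s y) \<le> mdist X x y"
    and bounded: "bounded_orbits X act"
  obtains \<phi> :: "'a \<Rightarrow> real"
  where "\<And>x. x \<in> mspace X \<Longrightarrow> \<phi> x > 0"
    and "\<And>x y. x \<in> mspace X \<Longrightarrow> y \<in> mspace X \<Longrightarrow> \<phi> x \<le> mdist X x y + \<phi> y"
    and "\<And>x y. x \<in> mspace X \<Longrightarrow> y \<in> mspace X \<Longrightarrow> mdist X x y \<le> \<phi> x + \<phi> y"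
    and "\<And>s x. x \<in> mspace X \<Longrightarrow> \<phi> (act s x) \<le> \<phi> x"
proof (cases "mspace X = {}")
  case True
  then show thesis
    using that by blast
next
  case False
  then obtain x0 where x0: "x0 \<in> mspace X"
    by blast
  interpret X: Metric_space "mspace X" "mdist X"
    by simp
  define H where "H x = mdist X x0 ` insert x (orbit_of act x)" for x
  define \<phi> where "\<phi> x = 1 + Sup (H x)" for x
  have in_X: "act s x \<in> mspace X" if "x \<in> mspace X" for s x
    using action that by (simp add: semigroup_action_on_def)
  have H_iff: "r \<in> H x \<longleftrightarrow> r = mdist X x0 x \<or> (\<exists>s. r = mdist X x0 (act s x))" for r x
    by (auto simp: H_def orbit_of_def)
  have H_ne: "H x \<noteq> {}" for x
    by (simp add: H_def)
  have bdd: "bdd_above (H x)" if x: "x \<in> mspace X" for x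
  proof -
    obtain B where B: "\<And>s t. mdist X (act s x) (act t x) \<le> B"
      using bounded x unfolding bounded_orbits_def X.mbounded_alt orbit_of_def by blast
    \<comment> \<open>The orbit is non-empty; \<open>undefined\<close> serves as an arbitrary element of the semigroup.\<close>
    have "mdist X x0 (act s x) \<le> mdist X x0 (act undefined x) + B" for s
      using X.triangle[OF x0 in_X[OF x] in_X[OF x], of s undefined] B[of undefined s] by linarith
    then show ?thesis
      unfolding bdd_above_def
      by (intro exI[of _ "max (mdist X x0 x) (mdist X x0 (act undefined x) + B)"])
        (auto simp: H_iff le_max_iff_disj)
  qed
  have ge_dist: "mdist X x0 x + 1 \<le> \<phi> x" if "x \<in> mspace X" for x
    using cSup_upper[OF _ bdd[OF that]] by (simp add: \<phi>_def H_iff)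
  show thesis
  proof
    show "\<phi> x > 0" if "x \<in> mspace X" for x
      using ge_dist[OF that] X.nonneg[of x0 x] by linarith
    show "\<phi> x \<le> mdist X x y + \<phi> y" if xy: "x \<in> mspace X" "y \<in> mspace X" for x y
    proof -
      have "r \<le> mdist X x y + Sup (H y)" if "r \<in> H x" for r
      proof -
        obtain r' where "r' \<in> H y" "r \<le> mdist X x y + r'"
        proof -
          consider "r = mdist X x0 x" | s where "r = mdist X x0 (act s x)"
            using \<open>r \<in> H x\<close> by (auto simp: H_iff)
          then show thesis
          proof cases
            case 1
            then show thesis
              using that[of "mdist X x0 y"] X.triangle[OF x0 xy(2,1)]
              by (simp add: H_iff X.commute)
          next
            case (2 s)
            then show thesis
              using that[of "mdist X x0 (act s y)"] nonexp[OF xy, of s]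
                X.triangle[OF x0 in_X[OF xy(2)] in_X[OF xy(1)], of s s]
              by (auto simp: H_iff X.commute)
          qed
        qed
        then show ?thesis
          using cSup_upper[OF _ bdd[OF xy(2)], of r'] by linarith
      qed
      then have "Sup (H x) \<le> mdist X x y + Sup (H y)"
        by (intro cSup_least H_ne) auto
      then show ?thesis
        by (simp add: \<phi>_def)
    qed
    show "mdist X x y \<le> \<phi> x + \<phi> y" if xy: "x \<in> mspace X" "y \<in> mspace X" for x y
      using X.triangle[OF xy(1) x0 xy(2)] ge_dist[OF xy(1)] ge_dist[OF xy(2)]
      by (simp add: X.commute)
    show "\<phi> (act s x) \<le> \<phi> x" if x: "x \<in> mspace X" for s x
    proof -
      have "act t (act s x) = act (t * s) x" for t
        using action x by (simp add: semigroup_action_on_def)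
      then have "H (act s x) \<subseteq> H x"
        by (auto simp: H_iff)
      then show ?thesis
        using cSup_subset_mono[OF H_ne bdd[OF x]] by (simp add: \<phi>_def)
    qed
  qed
qed

section \<open>One-point extensions\<close>

text \<open>\<open>\<phi>\<close> is the distance to the added point \<open>None\<close>. Absolute values are taken because a metric in
  the sense of \<^locale>\<open>Metric_space\<close> is nonnegative also outside its carrier, where \<open>\<phi>\<close> is
  arbitrary.\<close>

fun one_point_dist :: "('a \<Rightarrow> 'a \<Rightarrow> real) \<Rightarrow> ('a \<Rightarrow> real) \<Rightarrow> 'a option \<Rightarrow> 'a option \<Rightarrow> real" where
  "one_point_dist d \<phi> (Some x) (Some y) = d x y"
| "one_point_dist d \<phi> (Some x) None = \<bar>\<phi> x\<bar>"
| "one_point_dist d \<phi> None (Some y) = \<bar>\<phi> y\<bar>"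
| "one_point_dist d \<phi> None None = 0"

lemma (in Metric_space) Metric_space_one_point_dist:
  assumes pos: "\<And>x. x \<in> M \<Longrightarrow> \<phi> x > 0"
    and lip: "\<And>x y. x \<in> M \<Longrightarrow> y \<in> M \<Longrightarrow> \<phi> x \<le> d x y + \<phi> y"
    and tri: "\<And>x y. x \<in> M \<Longrightarrow> y \<in> M \<Longrightarrow> d x y \<le> \<phi> x + \<phi> y"
  shows "Metric_space (insert None (Some ` M)) (one_point_dist d \<phi>)"
proof
  fix a b c
  show "0 \<le> one_point_dist d \<phi> a b"
    by (cases a; cases b) auto
  show "one_point_dist d \<phi> a b = one_point_dist d \<phi> b a"
    by (cases a; cases b) (auto simp: commute)
  assume a: "a \<in> insert None (Some ` M)" and b: "b \<in> insert None (Some ` M)"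
  show "one_point_dist d \<phi> a b = 0 \<longleftrightarrow> a = b"
    using a b by (auto dest: pos)
  assume c: "c \<in> insert None (Some ` M)"
  show "one_point_dist d \<phi> a c \<le> one_point_dist d \<phi> a b + one_point_dist d \<phi> b c"
    using a b c
  proof (cases a; cases b; cases c)
    fix y z assume "a = None" "b = Some y" "c = Some z"
    then show ?thesis
      using b c lip[of z y] pos[of y] pos[of z] by (auto simp: commute)
  next
    fix x y assume "a = Some x" "b = Some y" "c = None"
    then show ?thesis
      using a b lip[of x y] pos[of x] pos[of y] by auto
  next
    fix x z assume "a = Some x" "b = None" "c = Some z"
    then show ?thesis
      using a c tri[of x z] pos[of x] pos[of z] by auto
  next
    fix x y z assume "a = Some x" "b = Some y" "c = Some z"
    then show ?thesis
      using a b c triangle by auto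
  qed auto
qed

text \<open>Each orbit map of the extension is an orbit map of \<open>X\<close> composed with the isometry \<open>Some\<close>,
  or constant; hence the new action inherits continuity. That \<open>\<phi>\<close> decreases along orbits is what
  makes distances to the new point non-increasing.\<close>

lemma bounded_orbits_imp_fixed_point_extension:
  fixes X :: "'a metric"
    and act :: "'s::topological_semigroup_mult \<Rightarrow> 'a \<Rightarrow> 'a"
  assumes "nonexpansive_action X act" and bounded: "bounded_orbits X act"
  shows "\<exists>(Y :: 'a option metric) actY. fixed_point_extension X act Y actY"
proof -
  interpret X: Metric_space "mspace X" "mdist X"
    by simp
  have action: "semigroup_action_on (mspace X) act"
    and nonexp: "\<And>s x y. x \<in> mspace X \<Longrightarrow> y \<in> mspace X \<Longrightarrow>
      mdist X (act s x) (act s y) \<le> mdist X x y"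
    and orbits: "\<And>x. x \<in> mspace X \<Longrightarrow> continuous_map euclidean (mtopology_of X) (\<lambda>s. act s x)"
    using assms(1) unfolding nonexpansive_action_iff_continuous_orbit_maps by auto
  obtain \<phi> :: "'a \<Rightarrow> real"
    where pos: "\<And>x. x \<in> mspace X \<Longrightarrow> \<phi> x > 0"
      and lip: "\<And>x y. x \<in> mspace X \<Longrightarrow> y \<in> mspace X \<Longrightarrow> \<phi> x \<le> mdist X x y + \<phi> y"
      and tri: "\<And>x y. x \<in> mspace X \<Longrightarrow> y \<in> mspace X \<Longrightarrow> mdist X x y \<le> \<phi> x + \<phi> y"
      and decreasing: "\<And>s x. x \<in> mspace X \<Longrightarrow> \<phi> (act s x) \<le> \<phi> x"
    using exists_decreasing_distance_function[OF action nonexp bounded] by metis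
  define Y where "Y = metric (insert None (Some ` mspace X), one_point_dist (mdist X) \<phi>)"
  define actY where "actY s = map_option (act s)" for s
  have metric: "Metric_space (insert None (Some ` mspace X)) (one_point_dist (mdist X) \<phi>)"
    using pos lip tri by (rule X.Metric_space_one_point_dist)
  have Y: "mspace Y = insert None (Some ` mspace X)" "mdist Y = one_point_dist (mdist X) \<phi>"
    unfolding Y_def using metric by (simp_all add: Metric_space.mspace_metric Metric_space.mdist_metric)
  have in_X: "act s x \<in> mspace X" if "x \<in> mspace X" for s x
    using action that by (simp add: semigroup_action_on_def)
  have emb: "isometric_embedding X Y Some"
    by (auto simp: isometric_embedding_def Y)
  have "continuous_map euclidean (mtopology_of Y) (\<lambda>s. actY s y)" if "y \<in> mspace Y" for y
  proof (cases y)
    case None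
    then show ?thesis
      using that by (simp add: actY_def)
  next
    case (Some x)
    then have "x \<in> mspace X"
      using that by (auto simp: Y)
    from continuous_map_compose[OF orbits[OF this] isometric_embedding_imp_continuous_map[OF emb]]
    show ?thesis
      by (simp add: Some actY_def o_def)
  qed
  moreover have "mdist Y (actY s a) (actY s b) \<le> mdist Y a b"
    if "a \<in> mspace Y" "b \<in> mspace Y" for s a b
    using that pos in_X decreasing nonexp by (auto simp: Y actY_def abs_of_pos)
  moreover have "semigroup_action_on (mspace Y) actY"
    using action by (auto simp: semigroup_action_on_def Y actY_def)
  ultimately have "nonexpansive_action Y actY"
    by (simp add: nonexpansive_action_iff_continuous_orbit_maps)
  moreover have "None \<in> mspace Y" "\<And>s. actY s None = None"
    by (simp_all add: Y actY_def)
  moreover have "equivariant_on (mspace X) act actY Some"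
    by (simp add: equivariant_on_def actY_def)
  ultimately show ?thesis
    using emb unfolding fixed_point_extension_def by blast
qed

section \<open>The equivalence\<close>

theorem theorem3:
  fixes X :: "'a metric"
    and act :: "'s::topological_semigroup_mult \<Rightarrow> 'a \<Rightarrow> 'a"
  assumes "nonexpansive_action X act"
  shows "((\<exists>(Y :: 'a option metric) actY. fixed_point_extension X act Y actY)
            \<longleftrightarrow> bounded_orbits X act) \<and>
         ((\<exists>(Y :: 'b metric) actY. fixed_point_extension X act Y actY)
            \<longrightarrow> bounded_orbits X act)"
proof -
  have action: "semigroup_action_on (mspace X) act"
    using assms by (simp add: nonexpansive_action_def)
  show ?thesis
    by (intro conjI iffI impI; (elim exE)?)
      (rule fixed_point_extension_imp_bounded_orbits[OF action]
        bounded_orbits_imp_fixed_point_extension[OF assms]; assumption)+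
qed

end
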